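(* Let $G$ be a cubic graph of order $n \in \{6, 8, 10, 14\}$. Then every $4$-total coloring of $G$ is equitable.
   Context: All graphs are finite, simple and cubic ($3$-regular), not necessarily connected. The order of a graph is its number of vertices. A $4$-total coloring of $G$ assigns one of the four colors $1,2,3,4$ to each vertex and each edge of $G$ so that adjacent vertices receive distinct colors, adjacent edges (edges sharing an endpoint) receive distinct colors, and every vertex and edge that are incident receive distinct colors. The color class $c_i$ is the set of all vertices and edges of color $i$. The coloring is equitable if $\bigl||c_i|-|c_j|\bigr| \le 1$ for all $i,j \in \{1,2,3,4\}$. *)

theory Defs
  imports Main
begin

definition simple_graph :: "'a set \<Rightarrow> 'a set set \<Rightarrow> bool" where
  "simple_graph V E \<longleftrightarrow> finite V \<and> (\<forall>e\<in>E. e \<subseteq> V \<and> card e = 2)"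

definition degree :: "'a set set \<Rightarrow> 'a \<Rightarrow> nat" where
  "degree E v = card {e \<in> E. v \<in> e}"

definition cubic_graph :: "'a set \<Rightarrow> 'a set set \<Rightarrow> bool" where
  "cubic_graph V E \<longleftrightarrow> simple_graph V E \<and> (\<forall>v\<in>V. degree E v = 3)"

text \<open>
  The objects coloured are the vertices (tagged with \<open>Inl\<close>) and the edges (tagged with \<open>Inr\<close>),
  that is, the elements of the disjoint sum \<open>V <+> E\<close>. Values of a colouring outside this
  set are unconstrained and irrelevant.
\<close>

definition total_coloring ::
    "nat \<Rightarrow> 'a set \<Rightarrow> 'a set set \<Rightarrow> ('a + 'a set \<Rightarrow> nat) \<Rightarrow> bool" where
  "total_coloring k V E c \<longleftrightarrow>
     (\<forall>x \<in> V <+> E. c x \<in> {1..k}) \<and>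
     (\<forall>u\<in>V. \<forall>v\<in>V. {u, v} \<in> E \<longrightarrow> c (Inl u) \<noteq> c (Inl v)) \<and>
     (\<forall>e\<in>E. \<forall>f\<in>E. e \<noteq> f \<and> e \<inter> f \<noteq> {} \<longrightarrow> c (Inr e) \<noteq> c (Inr f)) \<and>
     (\<forall>v\<in>V. \<forall>e\<in>E. v \<in> e \<longrightarrow> c (Inl v) \<noteq> c (Inr e))"

definition color_class ::
    "'a set \<Rightarrow> 'a set set \<Rightarrow> ('a + 'a set \<Rightarrow> nat) \<Rightarrow> nat \<Rightarrow> ('a + 'a set) set" where
  "color_class V E c i = {x \<in> V <+> E. c x = i}"

definition equitable ::
    "nat \<Rightarrow> 'a set \<Rightarrow> 'a set set \<Rightarrow> ('a + 'a set \<Rightarrow> nat) \<Rightarrow> bool" where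
  "equitable k V E c \<longleftrightarrow>
     (\<forall>i\<in>{1..k}. \<forall>j\<in>{1..k}.
        \<bar>int (card (color_class V E c i)) - int (card (color_class V E c j))\<bar> \<le> 1)"

end

(* Every vertex sees each of the four colors exactly once, on itself or on one of its three
   edges. Hence a color with a vertices has (n - a)/2 edges, so a is even and the class has size
   (n + a)/2: equitability says that the numbers a differ by at most 2. Exactly 3a edges meet the
   vertices of the color, and none of them has that color, so 3a + (n - a)/2 <= 3n/2, that is,
   5a <= 2n. Together with parity this settles n = 6, 8, 14. For n = 10 it leaves only the
   distribution (4, 4, 2, 0), where two colors i, j attain the bound. Then every edge not
   colored i meets the vertices of color i, and likewise for j. A vertex x of another color has
   an edge colored neither i nor j, whose other end would have both colors i and j. *)
theory Submission
  imports Defs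
begin

section \<open>Double counting of vertex-edge incidences\<close>

lemma sum_incidences:
  assumes "finite W" "finite F"
  shows "(\<Sum>v\<in>W. card {e \<in> F. v \<in> e}) = (\<Sum>e\<in>F. card (e \<inter> W))"
proof -
  have "(\<Sum>v\<in>W. card {e \<in> F. v \<in> e}) = (\<Sum>v\<in>W. \<Sum>e\<in>F. if v \<in> e then 1 else 0)"
    using assms by (simp add: sum.If_cases Int_def)
  also have "\<dots> = (\<Sum>e\<in>F. \<Sum>v\<in>W. if v \<in> e then 1 else 0)"
    by (rule sum.swap)
  also have "\<dots> = (\<Sum>e\<in>F. card (e \<inter> W))"
    using assms by (simp add: sum.If_cases Int_commute)
  finally show ?thesis .
qed

section \<open>Cubic total colorings and the colors around a vertex\<close>

locale cubic_total_coloring =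
  fixes V :: "'a set" and E :: "'a set set" and c :: "'a + 'a set \<Rightarrow> nat"
  assumes cubic: "cubic_graph V E" and coloring: "total_coloring 4 V E c"
begin

definition vertices_of :: "nat \<Rightarrow> 'a set" where
  "vertices_of i = {v \<in> V. c (Inl v) = i}"

definition edges_of :: "nat \<Rightarrow> 'a set set" where
  "edges_of i = {e \<in> E. c (Inr e) = i}"

lemma finite_V: "finite V"
  using cubic by (simp add: cubic_graph_def simple_graph_def)

lemma edge_subset: "e \<in> E \<Longrightarrow> e \<subseteq> V"
  using cubic by (simp add: cubic_graph_def simple_graph_def)

lemma card_edge: "e \<in> E \<Longrightarrow> card e = 2"
  using cubic by (simp add: cubic_graph_def simple_graph_def)

lemma finite_E: "finite E"
  by (rule finite_subset[of E "Pow V"]) (use finite_V edge_subset in auto)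

lemma finite_color [simp]: "finite (vertices_of i)" "finite (edges_of i)"
  using finite_V finite_E by (simp_all add: vertices_of_def edges_of_def)

lemma card_incident: "v \<in> V \<Longrightarrow> card {e \<in> E. v \<in> e} = 3"
  using cubic by (simp add: cubic_graph_def degree_def)

lemma adjacent_color_neq: "{u, v} \<in> E \<Longrightarrow> c (Inl u) \<noteq> c (Inl v)"
  using coloring edge_subset[of "{u, v}"] by (simp add: total_coloring_def)

lemma incident_edge_color_neq:
  "v \<in> e \<Longrightarrow> e \<in> E \<Longrightarrow> c (Inr e) \<noteq> c (Inl v)"
  using coloring edge_subset[of e] subsetD[of e V v]
  by (simp add: total_coloring_def eq_commute[of "c (Inr e)"])

lemma edge_color_inj:
  assumes "e \<in> E" "f \<in> E" "v \<in> e" "v \<in> f" "c (Inr e) = c (Inr f)"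
  shows "e = f"
proof -
  have "\<forall>e\<in>E. \<forall>f\<in>E. e \<noteq> f \<and> e \<inter> f \<noteq> {} \<longrightarrow> c (Inr e) \<noteq> c (Inr f)"
    using coloring by (simp add: total_coloring_def)
  moreover have "e \<inter> f \<noteq> {}" using assms by auto
  ultimately show ?thesis using assms by metis
qed

lemma vertex_color: "v \<in> V \<Longrightarrow> c (Inl v) \<in> {1..4}"
  using coloring by (simp add: total_coloring_def InlI)

lemma edge_color: "e \<in> E \<Longrightarrow> c (Inr e) \<in> {1..4}"
  using coloring by (simp add: total_coloring_def InrI)

text \<open>The three edges at \<open>v\<close> have pairwise distinct colors, none of them that of
  \<open>v\<close>, so by cardinality they use up the three remaining colors.\<close>

lemma incident_colors:
  assumes "v \<in> V"
  shows "(\<lambda>e. c (Inr e)) ` {e \<in> E. v \<in> e} = {1..4} - {c (Inl v)}"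
proof (rule card_subset_eq)
  show "(\<lambda>e. c (Inr e)) ` {e \<in> E. v \<in> e} \<subseteq> {1..4} - {c (Inl v)}"
    using edge_color incident_edge_color_neq by fastforce
  have "inj_on (\<lambda>e. c (Inr e)) {e \<in> E. v \<in> e}"
    using edge_color_inj by (auto intro!: inj_onI)
  then show "card ((\<lambda>e. c (Inr e)) ` {e \<in> E. v \<in> e}) = card ({1..4} - {c (Inl v)})"
    using vertex_color[OF assms] card_incident[OF assms] by (simp add: card_image)
qed simp

lemma exists_incident_edge:
  assumes "v \<in> V" "i \<in> {1..4}" "c (Inl v) \<noteq> i"
  obtains e where "e \<in> E" "v \<in> e" "c (Inr e) = i"
proof -
  have "i \<in> (\<lambda>e. c (Inr e)) ` {e \<in> E. v \<in> e}"
    unfolding incident_colors[OF assms(1)] using assms by simp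
  then show ?thesis using that by blast
qed

section \<open>Size of a color class\<close>

lemma card_incident_of_color:
  assumes "v \<in> V" "i \<in> {1..4}"
  shows "card {e \<in> edges_of i. v \<in> e} = (if c (Inl v) = i then 0 else 1)"
proof (cases "c (Inl v) = i")
  case True
  then have "{e \<in> edges_of i. v \<in> e} = {}"
    by (auto simp: edges_of_def dest: incident_edge_color_neq)
  then show ?thesis using True by simp
next
  case False
  then obtain e where e: "e \<in> E" "v \<in> e" "c (Inr e) = i"
    using exists_incident_edge assms by metis
  then have "{f \<in> edges_of i. v \<in> f} = {e}"
    using edge_color_inj by (auto simp: edges_of_def)
  then show ?thesis using False by simp
qed

text \<open>The edges of color \<open>i\<close> form a perfect matching of the vertices not colored
  \<open>i\<close>. Hence the number of vertices of a color determines the size of its class and has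
  the parity of the order.\<close>

lemma card_color:
  assumes "i \<in> {1..4}"
  shows "card (vertices_of i) + 2 * card (edges_of i) = card V"
proof -
  have "(\<Sum>v\<in>V. card {e \<in> edges_of i. v \<in> e}) = (\<Sum>v\<in>V. if c (Inl v) = i then 0 else 1)"
    using card_incident_of_color assms by (intro sum.cong) auto
  also have "\<dots> = card (V - vertices_of i)"
    using finite_V by (simp add: sum.If_cases vertices_of_def set_diff_eq Int_def)
      (rule arg_cong[where f = card], auto)
  finally have "card (V - vertices_of i) = (\<Sum>e\<in>edges_of i. card (e \<inter> V))"
    by (simp add: sum_incidences finite_V)
  also have "\<dots> = (\<Sum>e\<in>edges_of i. 2)"
    using edge_subset card_edge by (intro sum.cong) (auto simp: edges_of_def Int_absorb2)
  finally have "card (V - vertices_of i) = 2 * card (edges_of i)" by simp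
  moreover have "card (V - vertices_of i) + card (vertices_of i) = card V"
    using card_Diff_subset[of "vertices_of i" V] card_mono[of V "vertices_of i"] finite_V
    by (simp add: vertices_of_def)
  ultimately show ?thesis by simp
qed

section \<open>Edges that meet or avoid the vertices of a color\<close>

lemma edge_vertices_of:
  assumes "e \<in> E" "x \<in> e" "y \<in> e" "x \<in> vertices_of i" "y \<in> vertices_of i"
  shows "x = y"
proof (rule ccontr)
  assume "x \<noteq> y"
  then have "e = {x, y}"
    using assms card_edge by (metis card_2_iff doubleton_eq_iff insert_iff singletonD)
  then show False
    using assms adjacent_color_neq[of x y] by (simp add: vertices_of_def)
qed

definition edges_avoiding :: "nat \<Rightarrow> 'a set set" where
  "edges_avoiding i = {e \<in> E. e \<inter> vertices_of i = {}}"

lemma edges_of_subset_avoiding: "edges_of i \<subseteq> edges_avoiding i"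
  by (auto simp: edges_of_def edges_avoiding_def vertices_of_def dest: incident_edge_color_neq)

lemma finite_edges_avoiding: "finite (edges_avoiding i)"
  using finite_E by (simp add: edges_avoiding_def)

lemma card_edges: "2 * card E = 3 * card V"
proof -
  have "3 * card V = (\<Sum>v\<in>V. card {e \<in> E. v \<in> e})"
    using card_incident by simp
  also have "\<dots> = (\<Sum>e\<in>E. card (e \<inter> V))"
    by (rule sum_incidences[OF finite_V finite_E])
  also have "\<dots> = (\<Sum>e\<in>E. 2)"
    using edge_subset card_edge by (intro sum.cong) (auto simp: Int_absorb2)
  finally show ?thesis by simp
qed

text \<open>Each vertex of color \<open>i\<close> lies on three edges, and since these vertices are
  pairwise non-adjacent, no edge is counted twice.\<close>

lemma card_edges_avoiding: "3 * card (vertices_of i) + card (edges_avoiding i) = card E"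
proof -
  have *: "card (e \<inter> vertices_of i) = (if e \<in> edges_avoiding i then 0 else 1)" if "e \<in> E" for e
  proof (cases "e \<in> edges_avoiding i")
    case False
    with that obtain x where x: "x \<in> e" "x \<in> vertices_of i"
      by (auto simp: edges_avoiding_def)
    then have "e \<inter> vertices_of i = {x}"
      using edge_vertices_of that by blast
    then show ?thesis using False by simp
  qed (simp add: edges_avoiding_def)
  have "3 * card (vertices_of i) = (\<Sum>v\<in>vertices_of i. card {e \<in> E. v \<in> e})"
    using card_incident by (simp add: vertices_of_def)
  also have "\<dots> = (\<Sum>e\<in>E. card (e \<inter> vertices_of i))"
    by (rule sum_incidences) (simp_all add: finite_E)
  also have "\<dots> = (\<Sum>e\<in>E. if e \<in> edges_avoiding i then 0 else 1)"
    using * by simp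
  also have "\<dots> = card (E - edges_avoiding i)"
    using finite_E by (simp add: sum.If_cases Diff_eq)
  also have "\<dots> + card (edges_avoiding i) = card E"
    using card_Diff_subset[of "edges_avoiding i" E] card_mono[of E "edges_avoiding i"] finite_E
    by (simp add: edges_avoiding_def)
  finally show ?thesis by simp
qed

text \<open>The slack \<open>2 * card V - 5 * card (vertices_of i)\<close> is twice the number of
  edges in \<open>edges_avoiding i\<close> that are not colored \<open>i\<close>; the equality case
  below rests on this.\<close>

lemma card_vertices_of_le:
  assumes "i \<in> {1..4}"
  shows "5 * card (vertices_of i) \<le> 2 * card V"
  using card_color[OF assms] card_edges card_edges_avoiding[of i]
    card_mono[OF finite_edges_avoiding edges_of_subset_avoiding, of i]
  by linarith

section \<open>Colors attaining the bound\<close>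

lemma edges_avoiding_eq:
  assumes "i \<in> {1..4}" "5 * card (vertices_of i) = 2 * card V"
  shows "edges_avoiding i = edges_of i"
proof -
  have "card (edges_of i) = card (edges_avoiding i)"
    using card_color[OF assms(1)] card_edges card_edges_avoiding[of i] assms(2) by linarith
  then show ?thesis
    using card_subset_eq[OF finite_edges_avoiding edges_of_subset_avoiding] by metis
qed

lemma extremal_colors_cover:
  assumes i: "i \<in> {1..4}" "5 * card (vertices_of i) = 2 * card V"
    and j: "j \<in> {1..4}" "5 * card (vertices_of j) = 2 * card V"
    and "i \<noteq> j"
  shows "V = vertices_of i \<union> vertices_of j"
proof (rule ccontr)
  assume "V \<noteq> vertices_of i \<union> vertices_of j"
  then obtain x where x: "x \<in> V" "c (Inl x) \<noteq> i" "c (Inl x) \<noteq> j"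
    by (auto simp: vertices_of_def)
  \<comment> \<open>Three named colors leave a fourth one \<open>k\<close>, which must appear on an
    edge at \<open>x\<close>.\<close>
  have "\<not> {1..4} \<subseteq> {i, j, c (Inl x)}"
    using card_mono[of "{i, j, c (Inl x)}" "{1..4}"] by (auto simp: card_insert_if split: if_splits)
  then obtain k where k: "k \<in> {1..4}" "k \<noteq> i" "k \<noteq> j" "c (Inl x) \<noteq> k"
    by blast
  then obtain e where e: "e \<in> E" "x \<in> e" "c (Inr e) = k"
    using exists_incident_edge x(1) by metis
  \<comment> \<open>Extremality of \<open>i\<close> means that only edges colored \<open>i\<close>
    avoid its vertices, and likewise for \<open>j\<close>; the color \<open>k\<close> of
    \<open>e\<close> is neither.\<close>
  have "e \<notin> edges_avoiding i" "e \<notin> edges_avoiding j"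
    using edges_avoiding_eq i j e k by (auto simp: edges_of_def)
  then obtain y z where yz: "y \<in> e" "y \<in> vertices_of i" "z \<in> e" "z \<in> vertices_of j"
    using e by (auto simp: edges_avoiding_def)
  then have "x \<noteq> y" "x \<noteq> z" "y \<noteq> z"
    using x \<open>i \<noteq> j\<close> by (auto simp: vertices_of_def)
  \<comment> \<open>Finiteness comes from \<open>card e = 2\<close>, as an infinite set has
    cardinality 0.\<close>
  moreover have "{x, y, z} \<subseteq> e" "finite e"
    using e yz card_edge[OF e(1)] card.infinite by fastforce+
  ultimately show False
    using card_mono[of e "{x, y, z}"] card_edge[OF e(1)] by simp
qed

text \<open>Two such colors would cover all vertices, yet together they have only four fifths of
  them.\<close>

lemma at_most_one_extremal_color:
  assumes i: "i \<in> {1..4}" "5 * card (vertices_of i) = 2 * card V"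
    and j: "j \<in> {1..4}" "5 * card (vertices_of j) = 2 * card V"
    and "V \<noteq> {}"
  shows "i = j"
proof (rule ccontr)
  assume "i \<noteq> j"
  then have "card V \<le> card (vertices_of i) + card (vertices_of j)"
    using extremal_colors_cover[OF i j] card_Un_le by metis
  moreover have "card V > 0"
    using finite_V \<open>V \<noteq> {}\<close> by (simp add: card_gt_0_iff)
  ultimately show False
    using i j by linarith
qed

section \<open>Distribution of the vertices over the colors\<close>

lemma sum_card_vertices_of: "(\<Sum>i=1..4. card (vertices_of i)) = card V"
proof -
  have "card V = (\<Sum>i\<in>{1..4}. \<Sum>v\<in>{v \<in> V. c (Inl v) = i}. 1)"
    using vertex_color finite_V by (subst sum.group) auto
  then show ?thesis by (simp add: vertices_of_def)
qed

lemma card_color_class: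
  "card (color_class V E c i) = card (vertices_of i) + card (edges_of i)"
proof -
  have "color_class V E c i = vertices_of i <+> edges_of i"
    by (auto simp: color_class_def vertices_of_def edges_of_def)
  then show ?thesis by (simp add: card_Plus)
qed

lemma equitable_coloring:
  assumes "card V \<in> {6, 8, 10, 14}"
  shows "equitable 4 V E c"
proof -
  define a where "a = (\<lambda>i. card (vertices_of i))"
  define b where "b = (\<lambda>i. card (edges_of i))"
  have "V \<noteq> {}" using assms by auto
  have sum: "sum a {1..4} = card V"
    using sum_card_vertices_of by (simp add: a_def)
  have ab: "\<forall>i\<in>{1..4}. a i + 2 * b i = card V"
    using card_color by (simp add: a_def b_def)
  have le: "\<forall>i\<in>{1..4}. 5 * a i \<le> 2 * card V"
    using card_vertices_of_le by (simp add: a_def)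
  have extremal: "\<forall>i\<in>{1..4}. \<forall>j\<in>{1..4}. i \<noteq> j \<longrightarrow>
      5 * a i = 2 * card V \<longrightarrow> 5 * a j \<noteq> 2 * card V"
    using at_most_one_extremal_color \<open>V \<noteq> {}\<close> by (auto simp: a_def)
  \<comment> \<open>The order is even, hence so is \<open>a i\<close>, and
    \<open>5 * a i \<le> 28\<close> excludes 6 and above.\<close>
  have small: "a i \<in> {0, 2, 4}" if "i \<in> {1..4}" for i
  proof -
    have "card V \<le> 14" "even (card V)" using assms by auto
    moreover have "a i + 2 * b i = card V" "5 * a i \<le> 2 * card V"
      using ab le that by blast+
    ultimately have "a i < 6" "even (a i)" by presburger+
    then show ?thesis by simp presburger
  qed
  \<comment> \<open>Class sizes are \<open>(card V + a i) / 2\<close>, so a gap of 2 here is a gap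
    of 1 between classes. Among 0, 2 and 4, only the pair 4 and 0 violates the claim.\<close>
  have le2: "a i \<le> a j + 2" if ij: "i \<in> {1..4}" "j \<in> {1..4}" for i j
  proof (rule ccontr)
    assume "\<not> a i \<le> a j + 2"
    then have a: "a i = 4" "a j = 0"
      using small[OF ij(1)] small[OF ij(2)] by auto
    define R where "R = {1..4} - {i, j}"
    have "i \<noteq> j" using a by auto
    then have cardR: "card R = 2"
      using ij by (simp add: R_def card_Diff_subset)
    have "sum a {1..4} = sum a R + sum a {i, j}"
      unfolding R_def using ij by (intro sum.subset_diff) auto
    then have V: "card V = sum a R + 4"
      using sum a \<open>i \<noteq> j\<close> by simp
    have R: "k \<in> {1..4}" "k \<noteq> i" if "k \<in> R" for k
      using that by (auto simp: R_def)
    have "a k \<le> 4" if "k \<in> R" for k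
      using small[OF R(1)[OF that]] by auto
    \<comment> \<open>The two colors in \<open>R\<close> contribute at most 4 each, which excludes
      order 14; then \<open>5 * 4 \<le> 2 * card V\<close> excludes 6 and 8.\<close>
    then have "card V \<le> 12"
      using V sum_bounded_above[of R a 4] cardR by simp
    moreover have "5 * a i \<le> 2 * card V"
      using le ij by blast
    ultimately have "card V = 10"
      using assms a by auto
    \<comment> \<open>At order 10 the value 4 attains the bound, since
      \<open>5 * 4 = 2 * 10\<close>. Color \<open>i\<close> already does, so each color in
      \<open>R\<close> has at most 2 vertices, too few to reach 10.\<close>
    then have "a k \<noteq> 4" if "k \<in> R" for k
      using extremal ij(1) R[OF that] a by fastforce
    then have "a k \<le> 2" if "k \<in> R" for k
      using small[OF R(1)[OF that]] that by fastforce
    then have "card V \<le> 8"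
      using V sum_bounded_above[of R a 2] cardR by simp
    then show False using \<open>card V = 10\<close> by simp
  qed
  have "\<bar>int (a i + b i) - int (a j + b j)\<bar> \<le> 1" if "i \<in> {1..4}" "j \<in> {1..4}" for i j
  proof -
    have "a i \<le> a j + 2" "a j \<le> a i + 2" using that le2 by blast+
    then show ?thesis using bspec[OF ab that(1)] bspec[OF ab that(2)] by linarith
  qed
  then show ?thesis
    unfolding equitable_def card_color_class a_def b_def by blast
qed

end

theorem theorem4p1:
  fixes V :: "'a set" and E :: "'a set set" and c :: "'a + 'a set \<Rightarrow> nat"
  assumes "cubic_graph V E"
    and "card V \<in> {6, 8, 10, 14}"
    and "total_coloring 4 V E c"
  shows "equitable 4 V E c"
proof -
  interpret cubic_total_coloring V E c
    using assms(1,3) by unfold_locales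
  show ?thesis using assms(2) by (rule equitable_coloring)
qed

end
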